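(* Let $n\ge 2$, let $A=\{a_1,\dots,a_n\}$, and let $P_n$ be the polycyclic monoid on $A$. The monoid $\mathrm{Prem}(P_n)$ of premorphisms of $P_n$ is an ideal extension of the subsemigroup $\mathcal C$ by the monoid of affine maps $\mathrm{Aff}(A^* )$; that is, $\mathcal C$ is an ideal of $\mathrm{Prem}(P_n)$, and the complement $\mathrm{Prem}(P_n)\setminus\mathcal C$ is a submonoid isomorphic to $\mathrm{Aff}(A^* )$.
   Context: Functions are written on the right and composed left to right. $A^*$ is the free monoid on $A$. The polycyclic monoid $P_n$ is the inverse monoid with zero presented by $\langle A: a_ia_i^{-1}=1,\ a_ia_j^{-1}=0\ (i\ne j)\rangle$; its non-zero elements are uniquely of the form $u^{-1}v$ with $u,v\in A^*$, its non-zero idempotents are the $u^{-1}u$, and the natural partial order is given by $0\le x$ for all $x\in P_n$ and $(pu)^{-1}(pv)\le u^{-1}v$ for $p,u,v\in A^*$. In particular $w^{-1}w\le t^{-1}t$ iff $t$ is a suffix of $w$. A premorphism of $P_n$ is a function $\theta:P_n\to P_n$ with $(xy)\theta\le(x\theta)(y\theta)$ for all $x,y$; $\mathrm{Prem}(P_n)$ is the monoid of all premorphisms under composition. $\mathcal C\subseteq\mathrm{Prem}(P_n)$ consists of: the constant map $c_0$ with value $0$; and, for $w,t\in A^*$ with $t$ a suffix of $w$, the map $c_{w,t}$ sending $0\mapsto w^{-1}w$ and every non-zero element of $P_n$ to $t^{-1}t$. An affine map on $A^*$ is a map $A^*\to A^*$ of the form $x\mapsto(x\sigma)u$, where $\sigma$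 is an endomorphism of the monoid $A^*$ and $u\in A^*$; $\mathrm{Aff}(A^* )$ is the monoid of all affine maps under composition. *)

theory Defs
  imports "HOL-Algebra.Group" "HOL-Library.Cardinality" "HOL-Library.Sublist"
begin

text \<open>
  Functions are written on the right and composed from left to right in the mathematics formalized
  here; accordingly \<open>\<theta> \<otimes> \<phi>\<close> is \<open>\<phi> \<circ> \<theta>\<close> in the monoids of functions below.
  The alphabet is the set of all elements of a type \<open>'a\<close>, and the free monoid on it is \<open>'a list\<close>.
\<close>

section \<open>The polycyclic monoid\<close>

text \<open>
  Words over the alphabet and its formal inverses, with a zero (\<open>None\<close>) adjoined, form the free
  monoid with involution and zero.
\<close>

datatype 'a letter = Pos 'a | Neg 'a

fun flip :: "'a letter \<Rightarrow> 'a letter" where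
  "flip (Pos a) = Neg a"
| "flip (Neg a) = Pos a"

type_synonym 'a zword = "'a letter list option"

fun zmult :: "'a zword \<Rightarrow> 'a zword \<Rightarrow> 'a zword" where
  "zmult (Some x) (Some y) = Some (x @ y)"
| "zmult _ _ = None"

definition zinv :: "'a zword \<Rightarrow> 'a zword" where
  "zinv = map_option (\<lambda>w. rev (map flip w))"

text \<open>
  The rules \<open>regular\<close> and \<open>idem_comm\<close> generate the Wagner congruence, whose quotient is the free
  inverse monoid (with zero); \<open>rel_one\<close> and \<open>rel_zero\<close> are the polycyclic relations.
\<close>

inductive pcong :: "'a zword \<Rightarrow> 'a zword \<Rightarrow> bool" where
  refl: "pcong x x"
| sym: "pcong x y \<Longrightarrow> pcong y x"
| trans: "pcong x y \<Longrightarrow> pcong y z \<Longrightarrow> pcong x z"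
| mult: "pcong x x' \<Longrightarrow> pcong y y' \<Longrightarrow> pcong (zmult x y) (zmult x' y')"
| regular: "pcong (zmult (zmult x (zinv x)) x) x"
| idem_comm: "pcong (zmult (zmult x (zinv x)) (zmult y (zinv y)))
                    (zmult (zmult y (zinv y)) (zmult x (zinv x)))"
| rel_one: "pcong (Some [Pos a, Neg a]) (Some [])"
| rel_zero: "a \<noteq> b \<Longrightarrow> pcong (Some [Pos a, Neg b]) None"

lemma equivp_pcong: "equivp pcong"
  by (rule equivpI) (auto simp: reflp_def symp_def transp_def intro: pcong.intros)

quotient_type 'a polycyclic = "'a zword" / pcong
  by (rule equivp_pcong)

lemma zmult_assoc: "zmult (zmult x y) z = zmult x (zmult y z)"
  by (cases x; cases y; cases z) auto

lemma zmult_one [simp]: "zmult (Some []) x = x" "zmult x (Some []) = x"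
  by (cases x; simp)+

lemma zmult_None [simp]: "zmult None x = None" "zmult x None = None"
  by (cases x; simp)+

lemma flip_flip [simp]: "flip (flip l) = l"
  by (cases l) auto

lemma zinv_zinv [simp]: "zinv (zinv x) = x"
  by (cases x) (auto simp: zinv_def rev_map comp_def)

lemma zinv_zmult: "zinv (zmult x y) = zmult (zinv y) (zinv x)"
  by (cases x; cases y) (auto simp: zinv_def)

lemma pcong_zinv: "pcong x y \<Longrightarrow> pcong (zinv x) (zinv y)"
proof (induction rule: pcong.induct)
  case (regular x)
  show ?case using pcong.regular[of "zinv x"] by (simp add: zinv_zmult zmult_assoc)
next
  case (idem_comm x y)
  show ?case using pcong.idem_comm[of y x] by (simp add: zinv_zmult)
next
  case (rel_zero a b)
  then show ?case using pcong.rel_zero[of b a] by (simp add: zinv_def)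
qed (simp_all add: zinv_zmult, simp_all add: zinv_def pcong.intros(1,4,7), (blast intro: pcong.intros)+)

instantiation polycyclic :: (type) "{monoid_mult, mult_zero}"
begin

lift_definition zero_polycyclic :: "'a polycyclic" is None .

lift_definition one_polycyclic :: "'a polycyclic" is "Some []" .

lift_definition times_polycyclic :: "'a polycyclic \<Rightarrow> 'a polycyclic \<Rightarrow> 'a polycyclic" is zmult
  by (rule pcong.mult)

instance
  by standard (transfer; simp add: zmult_assoc pcong.refl)+

end

lift_definition pinv :: "'a polycyclic \<Rightarrow> 'a polycyclic" is zinv
  by (rule pcong_zinv)

lift_definition of_word :: "'a list \<Rightarrow> 'a polycyclic" is "\<lambda>w. Some (map Pos w)" .

text \<open>The element \<open>u\<inverse> v\<close>.\<close>

definition pelem :: "'a list \<Rightarrow> 'a list \<Rightarrow> 'a polycyclic" where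
  "pelem u v = pinv (of_word u) * of_word v"

text \<open>
  The natural partial order of an inverse monoid: \<open>x \<le> y\<close> iff \<open>x = e y\<close> for some idempotent \<open>e\<close>.
  Its description in terms of normal forms is lemma \<open>polycyclic_le_iff\<close> below.
\<close>

instantiation polycyclic :: (type) ord
begin

definition less_eq_polycyclic :: "'a polycyclic \<Rightarrow> 'a polycyclic \<Rightarrow> bool" where
  "less_eq_polycyclic x y \<longleftrightarrow> (\<exists>e. e * e = e \<and> x = e * y)"

definition less_polycyclic :: "'a polycyclic \<Rightarrow> 'a polycyclic \<Rightarrow> bool" where
  "less_polycyclic x y \<longleftrightarrow> x \<le> y \<and> \<not> y \<le> (x :: 'a polycyclic)"

instance ..

end

section \<open>Normal forms\<close>

text \<open>
  The right action by partial injections on words: \<open>a\<close> appends the letter \<open>a\<close>, and \<open>a\<inverse>\<close> removes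
  a final \<open>a\<close>.
\<close>

fun lact :: "'a letter \<Rightarrow> 'a list \<Rightarrow> 'a list option" where
  "lact (Pos a) x = Some (x @ [a])"
| "lact (Neg a) x = (if x \<noteq> [] \<and> last x = a then Some (butlast x) else None)"

fun wact :: "'a letter list \<Rightarrow> 'a list \<Rightarrow> 'a list option" where
  "wact [] x = Some x"
| "wact (l # w) x = Option.bind (lact l x) (wact w)"

definition zact :: "'a zword \<Rightarrow> 'a list \<Rightarrow> 'a list option" where
  "zact z x = Option.bind z (\<lambda>w. wact w x)"

lemma wact_append: "wact (v @ w) x = Option.bind (wact v x) (wact w)"
proof (induction v arbitrary: x)
  case (Cons l v)
  then show ?case by (cases "lact l x") auto
qed simp

lemma zact_zmult: "zact (zmult y z) x = Option.bind (zact y x) (zact z)"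
  by (cases y; cases z) (auto simp: zact_def wact_append cong: Option.bind_cong split: Option.bind_splits)

lemma lact_flip: "lact (flip l) y = Some x \<longleftrightarrow> lact l x = Some y"
  by (cases l) (auto split: if_splits simp: snoc_eq_iff_butlast)

lemma wact_inv: "wact (rev (map flip w)) y = Some x \<longleftrightarrow> wact w x = Some y"
proof (induction w arbitrary: x y)
  case (Cons l w)
  have "wact (rev (map flip (l # w))) y = Some x \<longleftrightarrow>
        (\<exists>z. wact (rev (map flip w)) y = Some z \<and> lact (flip l) z = Some x)"
    by (auto simp: wact_append Option.bind_eq_Some_conv)
  then show ?case
    by (auto simp: Cons.IH lact_flip Option.bind_eq_Some_conv)
qed auto

lemma zact_zinv: "zact (zinv z) y = Some x \<longleftrightarrow> zact z x = Some y"
  by (cases z) (auto simp: zact_def zinv_def wact_inv)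

lemma zact_inj: "zact z x = Some y \<Longrightarrow> zact z x' = Some y \<Longrightarrow> x = x'"
  by (metis zact_zinv option.inject)

lemma zact_idem: "zact (zmult z (zinv z)) x = (if zact z x = None then None else Some x)"
  by (cases "zact z x") (auto simp: zact_zmult zact_zinv)

lemma zact_pcong: "pcong y z \<Longrightarrow> zact y = zact z"
proof (induction rule: pcong.induct)
  case (mult x x' y y')
  then show ?case by (intro ext) (simp add: zact_zmult)
next
  case (regular x)
  show ?case
    by (rule ext) (simp add: zact_zmult[of "zmult x (zinv x)"] zact_idem)
next
  case (idem_comm x y)
  show ?case
    by (rule ext) (simp add: zact_zmult[of "zmult x (zinv x)"] zact_zmult[of "zmult y (zinv y)"] zact_idem)
qed (auto simp: zact_def fun_eq_iff)

lift_definition act :: "'a polycyclic \<Rightarrow> 'a list \<Rightarrow> 'a list option" is zact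
  by (simp add: zact_pcong)

lemma act_zero [simp]: "act 0 x = None"
  by transfer (simp add: zact_def)

lemma act_one [simp]: "act 1 x = Some x"
  by transfer (simp add: zact_def)

lemma act_mult: "act (p * q) x = Option.bind (act p x) (act q)"
  by transfer (rule zact_zmult)

lemma act_pinv: "act (pinv p) y = Some x \<longleftrightarrow> act p x = Some y"
  by transfer (rule zact_zinv)

lemma act_inj: "act p x = Some y \<Longrightarrow> act p x' = Some y \<Longrightarrow> x = x'"
  by transfer (rule zact_inj)

lemma act_of_word: "act (of_word w) x = Some (x @ w)"
proof (transfer fixing: w x)
  have "wact (map Pos w) x = Some (x @ w)" by (induction w arbitrary: x) auto
  then show "zact (Some (map Pos w)) x = Some (x @ w)" by (simp add: zact_def)
qed

lemma act_pelem: "act (pelem u v) x = Some y \<longleftrightarrow> (\<exists>k. x = k @ u \<and> y = k @ v)"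
  by (auto simp: pelem_def act_mult act_of_word act_pinv Option.bind_eq_Some_conv)

lemma pelem_neq_zero [simp]: "pelem u v \<noteq> 0" "0 \<noteq> pelem u v"
  by (metis act_zero act_pelem append_Nil option.distinct(1))+

lemma pelem_eq_iff [simp]: "pelem u v = pelem p q \<longleftrightarrow> u = p \<and> v = q"
proof
  assume eq: "pelem u v = pelem p q"
  have "act (pelem p q) u = Some v" unfolding eq[symmetric] act_pelem by simp
  moreover have "act (pelem u v) p = Some q" unfolding eq act_pelem by simp
  ultimately show "u = p \<and> v = q" by (auto simp: act_pelem)
qed auto

lemma of_word_append: "of_word (u @ v) = of_word u * of_word v"
  by transfer (simp add: pcong.refl)

lemma pinv_mult: "pinv (x * y) = pinv y * pinv x"
  by transfer (simp add: zinv_zmult pcong.refl)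

lemma of_word_Nil [simp]: "of_word [] = 1"
  by transfer (simp add: pcong.refl)

lemma pinv_one [simp]: "pinv 1 = 1"
  by transfer (simp add: zinv_def pcong.refl)

lemma one_eq_pelem: "1 = pelem [] []"
  by (simp add: pelem_def)

lemma of_word_pinv_letter: "of_word [a] * pinv (of_word [b]) = (if a = b then 1 else 0)"
  by (cases "a = b"; simp; transfer) (auto simp: zinv_def intro: pcong.intros)

lemma polycyclic_normal_form: "x = 0 \<or> (\<exists>u v. x = pelem u v)"
proof -
  have step: "\<exists>u' v'. pelem u v * abs_polycyclic (Some [l]) = pelem u' v' \<or>
                      pelem u v * abs_polycyclic (Some [l]) = 0" for u v :: "'b list" and l
  proof (cases l)
    case (Pos a)
    then have "abs_polycyclic (Some [l]) = of_word [a]"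
      by (simp add: of_word.abs_eq)
    then have "pelem u v * abs_polycyclic (Some [l]) = pelem u (v @ [a])"
      by (simp add: pelem_def of_word_append mult.assoc)
    then show ?thesis by blast
  next
    case (Neg a)
    then have l: "abs_polycyclic (Some [l]) = pinv (of_word [a])"
      by (simp add: of_word.abs_eq pinv.abs_eq zinv_def)
    show ?thesis
    proof (cases v rule: rev_cases)
      case Nil
      then have "pelem u v * abs_polycyclic (Some [l]) = pelem (a # u) []"
        unfolding l using of_word_append[of "[a]" u] by (simp add: pelem_def pinv_mult)
      then show ?thesis by blast
    next
      case (snoc v' b)
      then have "pelem u v * abs_polycyclic (Some [l]) =
                 pelem u v' * (of_word [b] * pinv (of_word [a]))"
        unfolding l by (simp add: pelem_def of_word_append mult.assoc)
      then show ?thesis by (auto simp: of_word_pinv_letter)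
    qed
  qed
  have "abs_polycyclic (Some w) = 0 \<or> (\<exists>u v. abs_polycyclic (Some w) = pelem u v)"
    for w :: "'a letter list"
  proof (induction w rule: rev_induct)
    case Nil
    show ?case
      by (metis one_polycyclic_def one_eq_pelem)
  next
    case (snoc l w)
    have "abs_polycyclic (Some (w @ [l])) = abs_polycyclic (Some w) * abs_polycyclic (Some [l])"
      by (simp add: times_polycyclic.abs_eq)
    with snoc step show ?case by (metis mult_zero_left)
  qed
  moreover have "abs_polycyclic None = (0 :: 'a polycyclic)"
    by (simp add: zero_polycyclic_def)
  moreover obtain z where "x = abs_polycyclic z"
    by (metis Quotient3_abs_rep Quotient3_polycyclic)
  ultimately show ?thesis by (cases z) auto
qed

lemma idempotent_iff_act: "e * e = e \<longleftrightarrow> (\<forall>x y. act e x = Some y \<longrightarrow> y = x)"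
proof
  assume e: "e * e = e"
  show "\<forall>x y. act e x = Some y \<longrightarrow> y = x"
  proof (intro allI impI)
    fix x y assume xy: "act e x = Some y"
    then have "act e y = Some y" using act_mult[of e e x] e by simp
    with xy show "y = x" using act_inj by blast
  qed
next
  assume e: "\<forall>x y. act e x = Some y \<longrightarrow> y = x"
  show "e * e = e"
  proof (cases "e = 0")
    case False
    then obtain u v where uv: "e = pelem u v" using polycyclic_normal_form by blast
    then have "act e u = Some v" by (simp add: act_pelem)
    with e have "v = u" by blast
    moreover have "of_word u * pinv (of_word u) = 1"
    proof (induction u rule: rev_induct)
      case (snoc a u)
      have "of_word (u @ [a]) * pinv (of_word (u @ [a])) =
            of_word u * (of_word [a] * pinv (of_word [a])) * pinv (of_word u)"
        by (simp add: of_word_append pinv_mult mult.assoc)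
      with snoc show ?case by (simp add: of_word_pinv_letter)
    qed simp
    ultimately show ?thesis unfolding uv pelem_def by (metis mult.assoc mult_1_right)
  qed simp
qed

lemma le_iff_act: "x \<le> y \<longleftrightarrow> act x \<subseteq>\<^sub>m act y"
proof
  assume "x \<le> y"
  then obtain e where e: "e * e = e" "x = e * y" by (auto simp: less_eq_polycyclic_def)
  show "act x \<subseteq>\<^sub>m act y"
    unfolding map_le_def
  proof
    fix a assume "a \<in> dom (act x)"
    then obtain b c where "act e a = Some b" "act y b = Some c" "act x a = Some c"
      by (auto simp: e(2) act_mult Option.bind_eq_Some_conv)
    then show "act x a = act y a" using e(1) by (metis idempotent_iff_act)
  qed
next
  assume le: "act x \<subseteq>\<^sub>m act y"
  show "x \<le> y"
  proof (cases "x = 0")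
    case True
    then show ?thesis unfolding less_eq_polycyclic_def by (intro exI[of _ 0]) simp
  next
    case False
    then obtain p q where x: "x = pelem p q" using polycyclic_normal_form by blast
    then have "act x p = Some q" by (simp add: act_pelem)
    then have yp: "act y p = Some q" using le by (metis domI map_le_def)
    have id: "pelem p p * pelem p p = pelem p p"
      by (auto simp: idempotent_iff_act act_pelem)
    have "y \<noteq> 0" using yp by auto
    then obtain u v where y: "y = pelem u v" using polycyclic_normal_form by blast
    with yp obtain k where k: "p = k @ u" "q = k @ v" by (auto simp: act_pelem)
    have "act (pelem p p * y) p = Some q"
      using yp by (auto simp: act_mult Option.bind_eq_Some_conv act_pelem)
    moreover from this obtain r s where rs: "pelem p p * y = pelem r s"
      by (metis act_zero option.distinct(1) polycyclic_normal_form)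
    ultimately obtain j where j: "p = j @ r" "q = j @ s" by (auto simp: act_pelem)
    have "act (pelem p p * y) r = Some s" by (simp add: rs act_pelem)
    then have "\<exists>i. r = i @ p" by (auto simp: act_mult Option.bind_eq_Some_conv act_pelem)
    with j have "r = p" "s = q" by auto
    with rs x id show ?thesis unfolding less_eq_polycyclic_def by metis
  qed
qed

lemma act_eqD: "act x = act y \<Longrightarrow> x = y"
proof -
  assume eq: "act x = act y"
  consider "x = 0" "y = 0" | u v where "x = pelem u v" "y = 0" | u v where "x = 0" "y = pelem u v"
    | u v p q where "x = pelem u v" "y = pelem p q"
    using polycyclic_normal_form by metis
  then show ?thesis
  proof cases
    case (4 u v p q)
    then have "act (pelem p q) u = Some v" "act (pelem u v) p = Some q"
      using eq act_pelem by (metis append_Nil)+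
    then show ?thesis using 4 by (auto simp: act_pelem)
  qed (metis eq act_zero act_pelem append_Nil option.distinct(1))+
qed

instance polycyclic :: (type) order
  by standard
    (auto simp: less_polycyclic_def le_iff_act intro: map_le_trans act_eqD map_le_antisym)

theorem polycyclic_le_iff:
  "x \<le> y \<longleftrightarrow> x = 0 \<or> (\<exists>p u v. x = pelem (p @ u) (p @ v) \<and> y = pelem u v)"
proof
  assume le: "x \<le> y"
  show "x = 0 \<or> (\<exists>p u v. x = pelem (p @ u) (p @ v) \<and> y = pelem u v)"
  proof (cases "x = 0")
    case False
    then obtain p q where x: "x = pelem p q" using polycyclic_normal_form by blast
    then have "act x p = Some q" by (simp add: act_pelem)
    then have yp: "act y p = Some q" using le unfolding le_iff_act by (metis domI map_le_def)
    then obtain u v where y: "y = pelem u v" by (metis act_zero option.distinct(1) polycyclic_normal_form)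
    with yp x show ?thesis by (auto simp: act_pelem)
  qed simp
next
  assume "x = 0 \<or> (\<exists>p u v. x = pelem (p @ u) (p @ v) \<and> y = pelem u v)"
  then show "x \<le> y"
  proof (elim disjE exE conjE)
    fix p u v assume xy: "x = pelem (p @ u) (p @ v)" "y = pelem u v"
    show "x \<le> y" unfolding le_iff_act map_le_def
    proof
      fix z assume "z \<in> dom (act x)"
      then obtain z' where z': "act x z = Some z'" by blast
      then have "act y z = Some z'" by (auto simp: xy act_pelem)
      with z' show "act x z = act y z" by simp
    qed
  qed (simp add: le_iff_act map_le_def dom_def)
qed

lemma pinv_regular: "x * pinv x * x = x"
  by transfer (rule pcong.regular)

lemma idempotents_commute:
  assumes "e * e = e" and "f * f = (f :: 'a polycyclic)"
  shows "e * f = f * e"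
proof (rule act_eqD, rule ext)
  fix x
  have "act e x = None \<or> act e x = Some x" "act f x = None \<or> act f x = Some x"
    using assms by (metis idempotent_iff_act option.exhaust)+
  then show "act (e * f) x = act (f * e) x" by (auto simp: act_mult)
qed

lemma pinv_pelem: "pinv (pelem u v) = pelem v u"
proof (rule act_eqD, rule ext)
  fix x
  have "act (pinv (pelem u v)) x = Some y \<longleftrightarrow> act (pelem v u) x = Some y" for y
    by (auto simp: act_pinv act_pelem)
  then show "act (pinv (pelem u v)) x = act (pelem v u) x"
    by (metis option.exhaust)
qed

lemma idempotent_iff: "e * e = e \<longleftrightarrow> e = 0 \<or> (\<exists>u. e = pelem u u)"
proof (cases "e = 0")
  case False
  then obtain u v where e: "e = pelem u v" using polycyclic_normal_form by blast
  have "(\<forall>x y. act e x = Some y \<longrightarrow> y = x) \<longleftrightarrow> u = v"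
    unfolding e act_pelem by auto
  then show ?thesis using False by (auto simp: e idempotent_iff_act)
qed simp

section \<open>Premorphisms\<close>

definition premorphism :: "('a polycyclic \<Rightarrow> 'a polycyclic) \<Rightarrow> bool" where
  "premorphism \<theta> \<longleftrightarrow> (\<forall>x y. \<theta> (x * y) \<le> \<theta> x * \<theta> y)"

definition Prem :: "('a polycyclic \<Rightarrow> 'a polycyclic) monoid" where
  "Prem = \<lparr>carrier = {\<theta>. premorphism \<theta>}, mult = (\<lambda>\<theta> \<phi>. \<phi> \<circ> \<theta>), one = id\<rparr>"

lemma premorphism_mono:
  assumes "premorphism \<theta>" and "x \<le> y"
  shows "\<theta> x \<le> \<theta> y"
proof -
  obtain e where e: "e * e = e" "x = e * y"
    using assms(2) by (auto simp: less_eq_polycyclic_def)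
  have "\<theta> e \<le> \<theta> e * \<theta> e" using assms(1) e(1) by (metis premorphism_def)
  then have sub: "act (\<theta> e) \<subseteq>\<^sub>m act (\<theta> e * \<theta> e)" by (simp add: le_iff_act)
  have "\<theta> e * \<theta> e = \<theta> e"
    unfolding idempotent_iff_act
  proof (intro allI impI)
    fix s t assume st: "act (\<theta> e) s = Some t"
    then have "act (\<theta> e * \<theta> e) s = Some t" using sub by (metis domI map_le_def)
    with st have "act (\<theta> e) t = Some t" by (simp add: act_mult)
    with st show "t = s" using act_inj by blast
  qed
  then have "\<theta> e * \<theta> y \<le> \<theta> y" by (auto simp: less_eq_polycyclic_def)
  moreover have "\<theta> x \<le> \<theta> e * \<theta> y" using assms(1) e(2) by (simp add: premorphism_def)
  ultimately show ?thesis by (rule order_trans[rotated])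
qed

theorem monoid_Prem: "Group.monoid Prem"
proof
  fix \<theta> \<phi> :: "'a polycyclic \<Rightarrow> 'a polycyclic"
  assume "\<theta> \<in> carrier Prem" "\<phi> \<in> carrier Prem"
  then have prem: "premorphism \<theta>" "premorphism \<phi>" by (simp_all add: Prem_def)
  have "\<phi> (\<theta> (x * y)) \<le> \<phi> (\<theta> x) * \<phi> (\<theta> y)" for x y
  proof (rule order_trans)
    show "\<phi> (\<theta> (x * y)) \<le> \<phi> (\<theta> x * \<theta> y)"
      using prem(1) by (intro premorphism_mono[OF prem(2)]) (simp add: premorphism_def)
    show "\<phi> (\<theta> x * \<theta> y) \<le> \<phi> (\<theta> x) * \<phi> (\<theta> y)"
      using prem(2) by (simp add: premorphism_def)
  qed
  then show "\<theta> \<otimes>\<^bsub>Prem\<^esub> \<phi> \<in> carrier Prem"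
    by (simp add: Prem_def premorphism_def)
qed (auto simp: Prem_def premorphism_def)

definition cmap :: "'a list \<Rightarrow> 'a list \<Rightarrow> 'a polycyclic \<Rightarrow> 'a polycyclic" where
  "cmap w t x = (if x = 0 then pelem w w else pelem t t)"

definition const_maps :: "('a polycyclic \<Rightarrow> 'a polycyclic) set" where
  "const_maps = insert (\<lambda>_. 0) {cmap w t |w t. suffix t w}"

section \<open>Affine maps\<close>

definition free_endo :: "('a list \<Rightarrow> 'a list) \<Rightarrow> bool" where
  "free_endo \<sigma> \<longleftrightarrow> \<sigma> [] = [] \<and> (\<forall>x y. \<sigma> (x @ y) = \<sigma> x @ \<sigma> y)"

definition affine_map :: "('a list \<Rightarrow> 'a list) \<Rightarrow> bool" where
  "affine_map \<alpha> \<longleftrightarrow> (\<exists>\<sigma> u. free_endo \<sigma> \<and> \<alpha> = (\<lambda>x. \<sigma> x @ u))"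

definition Aff :: "('a list \<Rightarrow> 'a list) monoid" where
  "Aff = \<lparr>carrier = {\<alpha>. affine_map \<alpha>}, mult = (\<lambda>\<alpha> \<beta>. \<beta> \<circ> \<alpha>), one = id\<rparr>"

theorem monoid_Aff: "Group.monoid Aff"
proof
  fix \<alpha> \<beta> :: "'a list \<Rightarrow> 'a list"
  assume "\<alpha> \<in> carrier Aff" "\<beta> \<in> carrier Aff"
  then obtain \<sigma> u \<tau> v where *: "free_endo \<sigma>" "\<alpha> = (\<lambda>x. \<sigma> x @ u)" "free_endo \<tau>" "\<beta> = (\<lambda>x. \<tau> x @ v)"
    by (auto simp: Aff_def affine_map_def)
  then have "free_endo (\<tau> \<circ> \<sigma>)" "\<beta> \<circ> \<alpha> = (\<lambda>x. (\<tau> \<circ> \<sigma>) x @ (\<tau> u @ v))"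
    by (auto simp: free_endo_def)
  then have "affine_map (\<beta> \<circ> \<alpha>)"
    unfolding affine_map_def by blast
  then show "\<alpha> \<otimes>\<^bsub>Aff\<^esub> \<beta> \<in> carrier Aff"
    by (simp add: Aff_def)
next
  have "free_endo (id :: 'a list \<Rightarrow> _)" "id = (\<lambda>x :: 'a list. id x @ [])"
    by (auto simp: free_endo_def)
  then have "affine_map (id :: 'a list \<Rightarrow> _)"
    unfolding affine_map_def by blast
  then show "\<one>\<^bsub>Aff\<^esub> \<in> carrier (Aff :: ('a list \<Rightarrow> 'a list) monoid)"
    by (simp add: Aff_def)
qed (auto simp: Aff_def)

section \<open>Ideals of monoids\<close>

definition monoid_ideal :: "'m set \<Rightarrow> ('m, 'b) monoid_scheme \<Rightarrow> bool" where
  "monoid_ideal I G \<longleftrightarrow> I \<noteq> {} \<and> I \<subseteq> carrier G \<and>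
     (\<forall>i\<in>I. \<forall>s\<in>carrier G. s \<otimes>\<^bsub>G\<^esub> i \<in> I \<and> i \<otimes>\<^bsub>G\<^esub> s \<in> I)"

end

theory Submission imports Defs begin

text \<open>
  The polycyclic monoid is \<open>0\<close>-simple: any non-zero element is a factor of every element.
  If \<open>0\<theta> \<noteq> 0\<close>, all values of a premorphism \<open>\<theta>\<close> lie above the idempotent \<open>0\<theta>\<close>, hence are
  idempotents, and \<open>0\<close>-simplicity makes \<open>\<theta>\<close> constant off \<open>0\<close>.  If \<open>0\<theta> = 0\<close> and \<open>\<theta>\<close> is not the zero
  map, then no non-zero element is sent to \<open>0\<close>; writing \<open>(u\<inverse> u)\<theta> = (u\<alpha>)\<inverse> (u\<alpha>)\<close>, preservation of
  inverses forces \<open>(u\<inverse> v)\<theta> = (u\<alpha>)\<inverse> (v\<alpha>)\<close>, and monotonicity applied to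
  \<open>p\<inverse> (p v) \<le> v\<close> forces \<open>\<alpha>\<close> to be affine.
\<close>

section \<open>Products and order in the polycyclic monoid\<close>

lemma pelem_cases:
  obtains "x = 0" | u v where "x = pelem u v"
  using polycyclic_normal_form by blast

lemma polycyclic_eqI:
  assumes "\<And>a b. act x a = Some b \<longleftrightarrow> act y a = Some b"
  shows "x = y"
  by (rule act_eqD, rule ext) (metis assms option.exhaust)

lemma polycyclic_leI:
  assumes "\<And>a b. act x a = Some b \<Longrightarrow> act y a = Some b"
  shows "x \<le> y"
  unfolding le_iff_act map_le_def using assms by fastforce

lemma polycyclic_leD: "x \<le> y \<Longrightarrow> act x a = Some b \<Longrightarrow> act y a = Some b"
  unfolding le_iff_act map_le_def by (metis domI)

lemma act_mult_eq_Some: "act (x * y) a = Some c \<longleftrightarrow> (\<exists>b. act x a = Some b \<and> act y b = Some c)"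
  by (auto simp: act_mult Option.bind_eq_Some_conv)

lemma zero_le_polycyclic [simp]: "0 \<le> (x :: 'a polycyclic)"
  by (rule polycyclic_leI) simp

lemma le_zero_polycyclic [simp]: "x \<le> 0 \<longleftrightarrow> x = (0 :: 'a polycyclic)"
  by (auto intro: antisym)

lemma pelem_le_pelem_iff: "pelem p q \<le> pelem u v \<longleftrightarrow> (\<exists>k. p = k @ u \<and> q = k @ v)"
  by (auto simp: polycyclic_le_iff)

lemma pelem_mult_right: "pelem u (p @ z) * pelem z w = pelem u (p @ w)"
  by (rule polycyclic_eqI) (auto simp: act_mult_eq_Some act_pelem)

lemma pelem_mult_left: "pelem u z * pelem (p @ z) w = pelem (p @ u) w"
  by (rule polycyclic_eqI) (auto simp: act_mult_eq_Some act_pelem)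

lemma pelem_mult [simp]: "pelem u z * pelem z w = pelem u w"
  using pelem_mult_right[of u "[]"] by simp

text \<open>A word reached between the two factors ends in both \<open>b\<close> and
  \<open>c\<close>, so one of these is a suffix of the other. Hence \<open>pelem_mult_right\<close>
  and \<open>pelem_mult_left\<close> cover every nonzero product.\<close>

lemma pelem_mult_nonzero:
  assumes "pelem a b * pelem c d \<noteq> 0"
  shows "\<exists>p. b = p @ c \<or> c = p @ b"
proof -
  obtain r s where "pelem a b * pelem c d = pelem r s"
    using assms by (cases "pelem a b * pelem c d" rule: pelem_cases) auto
  then have "act (pelem a b * pelem c d) r = Some s"
    by (simp add: act_pelem)
  then show ?thesis
    by (auto simp: act_mult_eq_Some act_pelem append_eq_append_conv2)
qed

lemma polycyclic_zero_simple:
  fixes x y :: "'a polycyclic"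
  assumes "x \<noteq> 0"
  obtains p q where "y = p * x * q"
proof -
  obtain a b where x: "x = pelem a b" using assms by (cases x rule: pelem_cases) auto
  show ?thesis
  proof (cases y rule: pelem_cases)
    case 1
    then show ?thesis using that[of 0 0] by simp
  next
    case (2 c d)
    then show ?thesis using that[of "pelem c a" "pelem b d"] by (simp add: x)
  qed
qed

lemma idempotent_act: "e * e = e \<Longrightarrow> act e a = Some b \<Longrightarrow> b = a"
  using idempotent_iff_act by blast

text \<open>If the partial injection \<open>x\<close> sends \<open>a\<close> to \<open>b\<close>,
  then so does \<open>x * x\<close>; thus \<open>x\<close> also sends \<open>b\<close> to
  \<open>b\<close>, and injectivity gives \<open>b = a\<close>. The premorphism law at an idempotent
  supplies the hypothesis.\<close>

lemma le_square_imp_idempotent: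
  assumes "x \<le> x * x"
  shows "x * x = (x :: 'a polycyclic)"
  unfolding idempotent_iff_act
proof (intro allI impI)
  fix a b assume ab: "act x a = Some b"
  with assms have "act (x * x) a = Some b" by (rule polycyclic_leD)
  with ab have "act x b = Some b" by (simp add: act_mult)
  with ab show "b = a" using act_inj by blast
qed

section \<open>Premorphisms\<close>

lemma premorphismD: "premorphism \<theta> \<Longrightarrow> \<theta> (x * y) \<le> \<theta> x * \<theta> y"
  by (simp add: premorphism_def)

lemma premorphism_act:
  "premorphism \<theta> \<Longrightarrow> act (\<theta> (x * y)) a = Some c \<Longrightarrow> \<exists>b. act (\<theta> x) a = Some b \<and> act (\<theta> y) b = Some c"
  using polycyclic_leD[OF premorphismD] by (metis act_mult_eq_Some)

lemma premorphism_idempotent: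
  assumes "premorphism \<theta>" and "e * e = e"
  shows "\<theta> e * \<theta> e = \<theta> e"
  using premorphismD[OF assms(1), of e e] assms(2) by (simp add: le_square_imp_idempotent)

text \<open>Follow \<open>a\<close> through \<open>x * pinv x * x\<close>, along \<open>a\<close>,
  \<open>c\<close>, \<open>d\<close>, \<open>b\<close>. Now \<open>\<theta> x\<close> sends
  \<open>a\<close> to both \<open>b\<close> and \<open>c\<close>, and both \<open>a\<close> and
  \<open>d\<close> to \<open>b\<close>, so \<open>c = b\<close> and \<open>d = a\<close>.\<close>

lemma premorphism_pinv_act:
  assumes "premorphism \<theta>" and "act (\<theta> x) a = Some b"
  shows "act (\<theta> (pinv x)) b = Some a"
proof -
  have "act (\<theta> (x * pinv x * x)) a = Some b"
    using assms(2) by (simp add: pinv_regular)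
  then obtain c d where "act (\<theta> x) a = Some c" "act (\<theta> (pinv x)) c = Some d" "act (\<theta> x) d = Some b"
    using premorphism_act[OF assms(1)] by blast
  with assms(2) show ?thesis using act_inj by (metis option.inject)
qed

lemma premorphism_pelem_idempotent:
  assumes "premorphism \<theta>"
  shows "\<theta> (pelem u u) = 0 \<or> (\<exists>v. \<theta> (pelem u u) = pelem v v)"
  using premorphism_idempotent[OF assms, of "pelem u u"] by (simp add: idempotent_iff)

text \<open>Every \<open>y\<close> factors through \<open>x\<close>, so its value is bounded by a
  product with a zero factor.\<close>

lemma premorphism_eq_zero:
  assumes "premorphism \<theta>" and "\<theta> x = 0" and "x \<noteq> 0"
  shows "\<theta> = (\<lambda>_. 0)"
proof
  fix y
  obtain p q where y: "y = p * x * q" using polycyclic_zero_simple[OF assms(3), of y] by blast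
  have "\<theta> (p * x) = 0"
    using premorphismD[OF assms(1), of p x] assms(2) by simp
  then show "\<theta> y = 0"
    using premorphismD[OF assms(1), of "p * x" q] y by simp
qed

lemma premorphism_nonzero_at_zero:
  assumes prem: "premorphism \<theta>" and nz: "\<theta> 0 \<noteq> 0"
  shows "\<theta> \<in> const_maps"
proof -
  obtain w where w: "\<theta> 0 = pelem w w"
    using premorphism_idempotent[OF prem, of 0] nz by (auto simp: idempotent_iff)
  have val: "\<exists>t. \<theta> x = pelem t t \<and> suffix t w" for x
  proof -
    have le: "pelem w w \<le> \<theta> x"
      using premorphism_mono[OF prem, of 0 x] by (simp add: w)
    then obtain u v where uv: "\<theta> x = pelem u v"
      by (cases "\<theta> x" rule: pelem_cases) auto
    with le show ?thesis by (auto simp: pelem_le_pelem_iff suffix_def)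
  qed
  have idem: "\<theta> x * \<theta> x = \<theta> x" for x
    using val[of x] by auto
  have le: "\<theta> y \<le> \<theta> x" if nzx: "x \<noteq> 0" for x y
  proof (rule polycyclic_leI)
    fix a b assume ab: "act (\<theta> y) a = Some b"
    obtain p q where "y = p * x * q" using polycyclic_zero_simple[OF nzx, of y] by blast
    with ab obtain c d where "act (\<theta> p) a = Some c" "act (\<theta> x) c = Some d" "act (\<theta> q) d = Some b"
      using premorphism_act[OF prem] by blast
    \<comment> \<open>All values are idempotents, hence restrictions of the identity, so
      \<open>a\<close>, \<open>c\<close>, \<open>d\<close> and \<open>b\<close> coincide.\<close>
    then show "act (\<theta> x) a = Some b" using idempotent_act[OF idem] by metis
  qed
  obtain t where t: "\<theta> 1 = pelem t t" "suffix t w" using val by blast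
  have "\<theta> x = pelem t t" if "x \<noteq> 0" for x
    using le[OF that, of 1] le[of 1 x] t by (metis antisym one_eq_pelem pelem_neq_zero(1))
  then have "\<theta> = cmap w t" by (auto simp: cmap_def w fun_eq_iff)
  then show ?thesis using t by (auto simp: const_maps_def)
qed

section \<open>The premorphism of an affine map\<close>

text \<open>Uniqueness of normal forms makes the description determinate; 0, which has no normal
  form, gets its own clause.\<close>

definition pmap :: "('a list \<Rightarrow> 'a list) \<Rightarrow> 'a polycyclic \<Rightarrow> 'a polycyclic" where
  "pmap \<alpha> x = (if x = 0 then 0 else THE y. \<exists>u v. x = pelem u v \<and> y = pelem (\<alpha> u) (\<alpha> v))"

lemma pmap_zero [simp]: "pmap \<alpha> 0 = 0"
  by (simp add: pmap_def)

lemma pmap_pelem [simp]: "pmap \<alpha> (pelem u v) = pelem (\<alpha> u) (\<alpha> v)"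
  by (simp add: pmap_def)

lemma pmap_comp: "pmap (\<beta> \<circ> \<alpha>) = pmap \<beta> \<circ> pmap \<alpha>"
proof
  show "pmap (\<beta> \<circ> \<alpha>) x = (pmap \<beta> \<circ> pmap \<alpha>) x" for x
    by (cases x rule: pelem_cases) auto
qed

lemma pmap_inj: "pmap \<alpha> = pmap \<beta> \<Longrightarrow> \<alpha> = \<beta>"
  by (metis ext pelem_eq_iff pmap_pelem)

lemma pmap_eq_zero_iff [simp]: "pmap \<alpha> x = 0 \<longleftrightarrow> x = 0"
  by (cases x rule: pelem_cases) auto

lemma pmap_id: "pmap id = id"
proof
  show "pmap id x = id x" for x :: "'a polycyclic"
    by (cases x rule: pelem_cases) auto
qed

text \<open>\<open>pmap \<alpha>\<close> vanishes exactly at 0, whereas members of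
  \<open>const_maps\<close> vanish everywhere or nowhere.\<close>

lemma pmap_notin_const_maps: "pmap \<alpha> \<notin> const_maps"
proof
  assume "pmap \<alpha> \<in> const_maps"
  then consider "pmap \<alpha> = (\<lambda>_. 0)" | w t where "pmap \<alpha> = cmap w t"
    by (auto simp: const_maps_def)
  then show False
  proof cases
    case 1
    from fun_cong[OF this, of "pelem [] []"] show False by simp
  next
    case 2
    from fun_cong[OF this, of 0] show False by (simp add: cmap_def)
  qed
qed

lemma premorphism_pmap:
  assumes "affine_map \<alpha>"
  shows "premorphism (pmap \<alpha>)"
  unfolding premorphism_def
proof (intro allI)
  fix x y
  obtain \<sigma> u where \<sigma>: "free_endo \<sigma>" "\<alpha> = (\<lambda>x. \<sigma> x @ u)"
    using assms by (auto simp: affine_map_def)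
  \<comment> \<open>This matches the prefix \<open>p\<close> in the product formulas, so that
    nonzero products are even preserved with equality.\<close>
  then have \<alpha>: "\<alpha> (p @ z) = \<sigma> p @ \<alpha> z" for p z
    by (simp add: free_endo_def)
  show "pmap \<alpha> (x * y) \<le> pmap \<alpha> x * pmap \<alpha> y"
  proof (cases "x * y = 0")
    case False
    obtain a b where x: "x = pelem a b" using False by (cases x rule: pelem_cases) auto
    obtain c d where y: "y = pelem c d" using False by (cases y rule: pelem_cases) auto
    from False obtain p where "b = p @ c \<or> c = p @ b"
      unfolding x y using pelem_mult_nonzero by blast
    then show ?thesis
      by (auto simp: x y pelem_mult_left pelem_mult_right \<alpha>)
  qed simp
qed

section \<open>Classification of the premorphisms\<close>

lemma premorphism_eq_pmap:
  assumes prem: "premorphism \<theta>" and nz: "\<And>x. x \<noteq> 0 \<Longrightarrow> \<theta> x \<noteq> 0" and zero: "\<theta> 0 = 0"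
  obtains \<alpha> where "affine_map \<alpha>" and "\<theta> = pmap \<alpha>"
proof -
  have "\<exists>v. \<theta> (pelem u u) = pelem v v" for u
    using premorphism_pelem_idempotent[OF prem] nz by (metis pelem_neq_zero(1))
  then obtain \<alpha> where \<alpha>: "\<And>u. \<theta> (pelem u u) = pelem (\<alpha> u) (\<alpha> u)" by metis
  have val: "\<theta> (pelem u v) = pelem (\<alpha> u) (\<alpha> v)" for u v
  proof -
    obtain p q where pq: "\<theta> (pelem u v) = pelem p q"
      using nz[of "pelem u v"] by (cases "\<theta> (pelem u v)" rule: pelem_cases) auto
    have "act (\<theta> (pelem u v)) p = Some q" by (simp add: pq act_pelem)
    moreover from this have inv: "act (\<theta> (pelem v u)) q = Some p"
      using premorphism_pinv_act[OF prem] by (metis pinv_pelem)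
    \<comment> \<open>Since u^{-1}v = (u^{-1}u)(u^{-1}v), the idempotent at
      \<open>\<alpha> u\<close> must be defined at \<open>p\<close>, so \<open>p\<close> ends in
      \<open>\<alpha> u\<close>; the inverse element treats \<open>q\<close> likewise.\<close>
    ultimately have "\<exists>k. p = k @ \<alpha> u" "\<exists>k. q = k @ \<alpha> v"
      using premorphism_act[OF prem, of "pelem u u" "pelem u v" p q]
        premorphism_act[OF prem, of "pelem v v" "pelem v u" q p]
      by (auto simp: \<alpha> act_pelem)
    \<comment> \<open>Conversely, u^{-1}u = (u^{-1}v)(v^{-1}u) makes the value defined at
      \<open>\<alpha> u\<close>, which must then end in \<open>p\<close>. Words that are suffixes of
      each other agree.\<close>
    moreover have "\<exists>k. \<alpha> u = k @ p"
      using premorphism_act[OF prem, of "pelem u v" "pelem v u" "\<alpha> u" "\<alpha> u"]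
      by (auto simp: \<alpha> pq act_pelem)
    moreover have "\<exists>k. \<alpha> v = k @ q"
    proof -
      obtain b where "act (\<theta> (pelem v u)) (\<alpha> v) = Some b" "act (\<theta> (pelem u v)) b = Some (\<alpha> v)"
        using premorphism_act[OF prem, of "pelem v u" "pelem u v" "\<alpha> v" "\<alpha> v"]
        by (auto simp: \<alpha> act_pelem)
      then show ?thesis by (auto simp: pq act_pelem)
    qed
    ultimately have "p = \<alpha> u" "q = \<alpha> v" by auto
    then show ?thesis by (simp add: pq)
  qed
  have shift: "\<exists>k. \<alpha> p = k @ \<alpha> [] \<and> \<alpha> (p @ v) = k @ \<alpha> v" for p v
  proof -
    \<comment> \<open>The order lengthens both coordinates by the same prefix, so one
      \<open>k\<close> serves both equations.\<close>
    have "pelem p (p @ v) \<le> pelem [] v" by (simp add: pelem_le_pelem_iff)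
    from premorphism_mono[OF prem this] show ?thesis
      by (simp add: val pelem_le_pelem_iff)
  qed
  then have "\<forall>p. \<exists>k. \<alpha> p = k @ \<alpha> []" by blast
  \<comment> \<open>\<open>\<sigma>\<close> strips the fixed suffix \<open>\<alpha> []\<close>, the
    translation part of the affine map.\<close>
  from choice[OF this] obtain \<sigma> where \<sigma>: "\<And>p. \<alpha> p = \<sigma> p @ \<alpha> []" by blast
  have shift\<sigma>: "\<alpha> (p @ v) = \<sigma> p @ \<alpha> v" for p v
    using shift[of p v] \<sigma>[of p] by auto
  have "free_endo \<sigma>"
    unfolding free_endo_def
  proof (intro conjI allI)
    show "\<sigma> [] = []" using \<sigma>[of "[]"] by simp
    show "\<sigma> (x @ y) = \<sigma> x @ \<sigma> y" for x y
      \<comment> \<open>Both expansions of \<open>\<alpha> (x @ y)\<close> end in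
        \<open>\<alpha> []\<close>, which cancels.\<close>
      using shift\<sigma>[of x y] \<sigma>[of "x @ y"] \<sigma>[of y] by (metis append.assoc append_same_eq)
  qed
  with \<sigma> have "affine_map \<alpha>" unfolding affine_map_def by blast
  moreover have "\<theta> = pmap \<alpha>"
  proof
    show "\<theta> x = pmap \<alpha> x" for x
      by (cases x rule: pelem_cases) (auto simp: zero val)
  qed
  ultimately show ?thesis using that by blast
qed

lemma premorphism_cases:
  assumes "premorphism \<theta>"
  obtains "\<theta> \<in> const_maps" | \<alpha> where "affine_map \<alpha>" and "\<theta> = pmap \<alpha>"
\<comment> \<open>The zero map also fixes 0 but lies in \<open>const_maps\<close>, so it is split
  off here.\<close>
proof (cases "\<theta> 0 = 0 \<and> \<theta> \<noteq> (\<lambda>_. 0)")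
  case True
  then show ?thesis
    using premorphism_eq_pmap[OF assms] premorphism_eq_zero[OF assms] that(2) by metis
next
  case False
  then show ?thesis
    using premorphism_nonzero_at_zero[OF assms] that(1) by (auto simp: const_maps_def)
qed

section \<open>The ideal extension\<close>

text \<open>As w^{-1}w \<le> t^{-1}t, any product of two values involving w^{-1}w equals w^{-1}w. A
  strict inequality can occur only for nonzero factors with product 0.\<close>

lemma premorphism_cmap:
  assumes "suffix t w"
  shows "premorphism (cmap w t)"
proof -
  obtain p where w: "w = p @ t" using assms by (auto simp: suffix_def)
  have "pelem w w * pelem t t = pelem w w" "pelem t t * pelem w w = pelem w w"
    unfolding w by (simp_all add: pelem_mult_right pelem_mult_left)
  moreover have "pelem w w \<le> pelem t t" by (simp add: w pelem_le_pelem_iff)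
  ultimately show ?thesis
    by (auto simp: premorphism_def cmap_def)
qed

lemma const_maps_subset_Prem: "const_maps \<subseteq> carrier Prem"
  by (auto simp: const_maps_def Prem_def premorphism_cmap) (simp add: premorphism_def)

lemma cmap_in_const_maps: "suffix t w \<Longrightarrow> cmap w t \<in> const_maps"
  by (auto simp: const_maps_def)

lemma const_maps_cases:
  assumes "c \<in> const_maps"
  obtains "c = (\<lambda>_. 0)" | w t where "c = cmap w t" and "suffix t w"
  using assms by (auto simp: const_maps_def)

text \<open>These are the zero map and the maps \<open>cmap u u\<close>; composites that no longer
  tell 0 from the other elements land here.\<close>

lemma constant_idempotent_in_const_maps: "e * e = e \<Longrightarrow> (\<lambda>_. e) \<in> const_maps"
proof -
  assume "e * e = e"
  then consider "e = 0" | u where "e = pelem u u" by (auto simp: idempotent_iff)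
  then show ?thesis
  proof cases
    case 2
    then have "(\<lambda>_. e) = cmap u u" by (auto simp: cmap_def)
    then show ?thesis by (simp add: cmap_in_const_maps)
  qed (simp add: const_maps_def)
qed

text \<open>In the order of multiplication of \<open>Prem\<close> this is the product of
  \<open>c\<close> followed by \<open>\<theta>\<close>.\<close>

lemma const_maps_comp_left:
  assumes c: "c \<in> const_maps" and \<theta>: "premorphism \<theta>"
  shows "\<theta> \<circ> c \<in> const_maps"
  using c
proof (cases rule: const_maps_cases)
  case 1
  then have "\<theta> \<circ> c = (\<lambda>_. \<theta> 0)" by auto
  with premorphism_idempotent[OF \<theta>, of 0] show ?thesis
    by (simp add: constant_idempotent_in_const_maps)
next
  case (2 w t)
  from \<theta> show ?thesis
  proof (cases rule: premorphism_cases)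
    case 1
    \<comment> \<open>\<open>c\<close> never takes the value 0 here, so only the constant behaviour
      of \<open>\<theta>\<close> off 0 is seen.\<close>
    have "\<theta> x = \<theta> y" if "x \<noteq> 0" "y \<noteq> 0" for x y
      using 1 that by (auto simp: const_maps_def cmap_def)
    then have "\<theta> \<circ> c = (\<lambda>_. \<theta> (pelem t t))" by (auto simp: 2 cmap_def)
    moreover have "\<theta> (pelem t t) * \<theta> (pelem t t) = \<theta> (pelem t t)"
      by (rule premorphism_idempotent[OF \<theta>]) simp
    ultimately show ?thesis by (simp add: constant_idempotent_in_const_maps)
  next
    case (2 \<alpha>)
    \<comment> \<open>The suffix relation is the order on idempotents, so monotonicity carries it
      over to the images under \<open>\<alpha>\<close>.\<close>
    have "pelem w w \<le> pelem t t"
      using \<open>suffix t w\<close> by (auto simp: suffix_def pelem_le_pelem_iff)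
    from premorphism_mono[OF \<theta> this] have "suffix (\<alpha> t) (\<alpha> w)"
      by (auto simp: 2 suffix_def pelem_le_pelem_iff)
    moreover have "\<theta> \<circ> c = cmap (\<alpha> w) (\<alpha> t)"
      by (auto simp: 2 \<open>c = cmap w t\<close> cmap_def)
    ultimately show ?thesis by (simp add: cmap_in_const_maps)
  qed
qed

text \<open>If \<open>\<theta>\<close> is in \<open>const_maps\<close>, the previous lemma applies
  with the roles exchanged, \<open>c\<close> being a premorphism itself. If \<open>\<theta>\<close>
  is some \<open>pmap \<alpha>\<close>, it preserves being zero and being nonzero, which is all that
  \<open>c\<close> distinguishes.\<close>

lemma const_maps_comp_right:
  assumes c: "c \<in> const_maps" and \<theta>: "premorphism \<theta>"
  shows "c \<circ> \<theta> \<in> const_maps"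
  using \<theta>
proof (cases rule: premorphism_cases)
  case 1
  have "premorphism c" using c const_maps_subset_Prem by (auto simp: Prem_def)
  with 1 show ?thesis by (rule const_maps_comp_left)
next
  case (2 \<alpha>)
  have "c \<circ> \<theta> = c"
    using c by (cases rule: const_maps_cases) (auto simp: 2 cmap_def)
  with c show ?thesis by simp
qed

lemma monoid_ideal_const_maps: "monoid_ideal const_maps Prem"
proof -
  have "const_maps \<noteq> {}" by (simp add: const_maps_def)
  then show ?thesis
    using const_maps_subset_Prem const_maps_comp_left const_maps_comp_right
    by (auto simp: monoid_ideal_def Prem_def)
qed

lemma Prem_minus_const_maps: "carrier Prem - const_maps = pmap ` carrier Aff"
  by (auto simp: Prem_def Aff_def premorphism_pmap pmap_notin_const_maps elim: premorphism_cases)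

lemma pmap_mult: "pmap (\<alpha> \<otimes>\<^bsub>Aff\<^esub> \<beta>) = pmap \<alpha> \<otimes>\<^bsub>Prem\<^esub> pmap \<beta>"
  by (simp add: Aff_def Prem_def pmap_comp)

text \<open>\<open>pmap\<close> runs from the affine maps to the complement, while the isomorphism
  of the theorem runs the other way; hence the inverse.\<close>

lemma inv_pmap_iso:
  "inv_into (carrier Aff) (pmap :: ('a list \<Rightarrow> 'a list) \<Rightarrow> _)
    \<in> iso (Prem\<lparr>carrier := carrier Prem - const_maps\<rparr>) Aff"
proof (rule isoI)
  have bij: "bij_betw pmap (carrier (Aff :: ('a list \<Rightarrow> 'a list) monoid)) (carrier Prem - const_maps)"
    unfolding Prem_minus_const_maps by (auto intro!: inj_on_imp_bij_betw inj_onI dest: pmap_inj)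
  then show "bij_betw (inv_into (carrier Aff) (pmap :: ('a list \<Rightarrow> 'a list) \<Rightarrow> _))
      (carrier (Prem\<lparr>carrier := carrier Prem - const_maps\<rparr>)) (carrier Aff)"
    by (simp add: bij_betw_inv_into)
  have inv: "inv_into (carrier Aff) pmap (pmap \<alpha>) = \<alpha>" if "\<alpha> \<in> carrier Aff" for \<alpha> :: "'a list \<Rightarrow> 'a list"
    using bij that by (simp add: bij_betw_def)
  interpret Aff: Group.monoid "Aff :: ('a list \<Rightarrow> 'a list) monoid" by (rule monoid_Aff)
  show "inv_into (carrier Aff) (pmap :: ('a list \<Rightarrow> 'a list) \<Rightarrow> _) \<in> hom (Prem\<lparr>carrier := carrier Prem - const_maps\<rparr>) Aff"
    unfolding Prem_minus_const_maps by (rule homI) (auto simp: inv pmap_mult[symmetric])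
qed

theorem proposition5p3:
  assumes "CARD('a::finite) \<ge> 2"
  shows "monoid_ideal (const_maps :: ('a polycyclic \<Rightarrow> 'a polycyclic) set) Prem \<and>
         submonoid (carrier Prem - (const_maps :: ('a polycyclic \<Rightarrow> 'a polycyclic) set)) Prem \<and>
         Prem\<lparr>carrier := carrier Prem - (const_maps :: ('a polycyclic \<Rightarrow> 'a polycyclic) set)\<rparr>
           \<cong> (Aff :: ('a list \<Rightarrow> 'a list) monoid)"
proof (intro conjI)
  interpret Aff: Group.monoid "Aff :: ('a list \<Rightarrow> 'a list) monoid" by (rule monoid_Aff)
  show "monoid_ideal (const_maps :: ('a polycyclic \<Rightarrow> 'a polycyclic) set) Prem"
    by (rule monoid_ideal_const_maps)
  show "submonoid (carrier Prem - (const_maps :: ('a polycyclic \<Rightarrow> 'a polycyclic) set)) Prem"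
  proof
    show "carrier Prem - const_maps \<subseteq> carrier (Prem :: ('a polycyclic \<Rightarrow> 'a polycyclic) monoid)"
      by blast
    fix \<theta> \<phi> :: "'a polycyclic \<Rightarrow> 'a polycyclic"
    assume "\<theta> \<in> carrier Prem - const_maps" "\<phi> \<in> carrier Prem - const_maps"
    then obtain \<alpha> \<beta> where \<alpha>: "\<alpha> \<in> carrier Aff" "\<theta> = pmap \<alpha>" and \<beta>: "\<beta> \<in> carrier Aff" "\<phi> = pmap \<beta>"
      unfolding Prem_minus_const_maps by blast
    then have "\<theta> \<otimes>\<^bsub>Prem\<^esub> \<phi> = pmap (\<alpha> \<otimes>\<^bsub>Aff\<^esub> \<beta>)"
      by (simp add: Prem_def Aff_def pmap_comp)
    then show "\<theta> \<otimes>\<^bsub>Prem\<^esub> \<phi> \<in> carrier Prem - const_maps"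
      unfolding Prem_minus_const_maps using \<alpha> \<beta> by blast
  next
    have "\<one>\<^bsub>Prem\<^esub> = pmap (\<one>\<^bsub>Aff\<^esub> :: 'a list \<Rightarrow> 'a list)"
      by (simp add: Prem_def Aff_def pmap_id)
    then show "\<one>\<^bsub>Prem\<^esub> \<in> carrier Prem - (const_maps :: ('a polycyclic \<Rightarrow> 'a polycyclic) set)"
      unfolding Prem_minus_const_maps using Aff.one_closed by blast
  qed
  show "Prem\<lparr>carrier := carrier Prem - (const_maps :: ('a polycyclic \<Rightarrow> 'a polycyclic) set)\<rparr>
          \<cong> (Aff :: ('a list \<Rightarrow> 'a list) monoid)"
    using inv_pmap_iso unfolding is_iso_def by blast
qed

end
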